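(* Let $c=pqrs$ be a conductor of cyclic cubic fields with four prime-power divisors $p,q,r,s$ (distinct primes $\equiv1\pmod 3$, or the prime power $9$). Let $\mathcal{G}$ be the directed graph on the vertex set $\{p,q,r,s\}$ with an arrow $x\to y$ ($x\ne y$) iff $\left(\frac{x}{y}\right)_3=1$. Suppose $\mathcal{G}$ satisfies: (1) there is no pair $x,y$ with both $x\to y$ and $y\to x$; (2) there is no attractive vertex; (3) there is no repulsive vertex; (4) for every $3$-element subset $\{x,y,z\}$ of vertices spanning no arrows, the invariant $\delta=a_{xy}a_{yz}a_{zx}-a_{xz}a_{zy}a_{yx}$ satisfies $\delta\not\equiv0\pmod 3$. Then for each of the four $3$-element subsets $\{p,q,r\},\{p,q,s\},\{p,r,s\},\{q,r,s\}$ the induced subgraph is of one of the types III.1, III.2, III.3, III.4; and $\mathcal{G}$ is isomorphic (as a directed graph) to one of the following seven graphs: (i) no arrows; (ii) $p\to q$ only; (iii) $p\to q$, $r\to s$ only; (iv) $p\to q\to r$ only; (v) $p\to q\to r\to p$ only; (vi) $p\to q\to r\to s$ only; (vii) $p\to q\to r\to s\to p$ only.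
   Context: Cubic residue symbols: $\left(\frac{x}{y}\right)_3=\zeta_3^{a_{xy}}$ with $a_{xy}\in\{-1,0,1\}$ (values in the cube roots of unity, with respect to fixed choices of primes of $\mathbb{Z}[\zeta_3]$ above the divisors; for the divisor $9$ the usual conventions apply), so $x\to y$ iff $a_{xy}=0$. A vertex $v$ is attractive if there are two distinct other vertices $u,w$ with $u\to v$ and $w\to v$; it is repulsive if there are two distinct other vertices $u,w$ with $v\to u$ and $v\to w$. Types of a directed graph on three vertices $\{x,y,z\}$: III.1 = no arrows and $\delta\not\equiv 0\pmod 3$ (with $\delta$ as in the claim); III.2 = exactly one arrow; III.3 = exactly two arrows, forming a directed path $x\to y\to z$ (for some ordering); III.4 = exactly three arrows, forming a directed $3$-cycle $x\to y\to z\to x$. A graph satisfying (1)–(4) is called the graph of a tame octet. *)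

theory Defs
  imports
    Complex_Main
    "HOL-Number_Theory.Cong"
    "HOL-Algebra.QuotRing"
    "Graph_Theory.Graph_Theory"
begin

definition zeta3 :: complex where
  "zeta3 = cis (2 * pi / 3)"

definition eisenstein_ring :: "complex ring" where
  "eisenstein_ring =
     \<lparr>carrier = {of_int a + of_int b * zeta3 | a b. True},
      monoid.mult = (*), one = 1, zero = 0, add = (+)\<rparr>"

definition prime_above :: "complex set \<Rightarrow> nat \<Rightarrow> bool" where
  "prime_above \<pp> y \<longleftrightarrow> primeideal \<pp> eisenstein_ring \<and> of_nat y \<in> \<pp>"

definition ideal_norm :: "complex set \<Rightarrow> nat" where
  "ideal_norm \<pp> = card (carrier (eisenstein_ring Quot \<pp>))"

text \<open>Euler's criterion; the value is unique when the norm is congruent to 1 modulo 3 and \<open>x \<notin> \<pp>\<close>.\<close>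

definition cubic_residue_symbol_prime :: "nat \<Rightarrow> complex set \<Rightarrow> complex" where
  "cubic_residue_symbol_prime x \<pp> =
     (THE z. z \<in> {1, zeta3, zeta3\<^sup>2} \<and>
             of_nat x ^ ((ideal_norm \<pp> - 1) div 3) - z \<in> \<pp>)"

text \<open>
  \<open>\<pp>\<close> selects the prime of \<open>\<int>[\<zeta>\<^sub>3]\<close> above each divisor.  The prime above 3 is ramified of norm 3
  and carries no cubic residue symbol; for the divisor 9 the symbol is a cubic character modulo 9,
  trivial exactly on the classes of \<open>1\<close> and \<open>-1\<close>, here \<open>x \<mapsto> \<zeta>\<^sub>3\<^bsup>(x\<^sup>2 - 1)/3\<^esup>\<close>.
  The only other nontrivial cubic character modulo 9 is its complex conjugate.  Like passing to
  the conjugate prime for another divisor, replacing one by the other leaves the arrows of the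
  residue graph unchanged and at most changes the sign of the invariant \<open>\<delta>\<close>.
\<close>

definition cubic_residue_symbol :: "(nat \<Rightarrow> complex set) \<Rightarrow> nat \<Rightarrow> nat \<Rightarrow> complex" where
  "cubic_residue_symbol \<pp> x y =
     (if y = 9 then zeta3 ^ ((x\<^sup>2 - 1) div 3) else cubic_residue_symbol_prime x (\<pp> y))"

definition cubic_residue_exponent :: "(nat \<Rightarrow> complex set) \<Rightarrow> nat \<Rightarrow> nat \<Rightarrow> int" where
  "cubic_residue_exponent \<pp> x y =
     (THE a. a \<in> {-1, 0, 1} \<and> cubic_residue_symbol \<pp> x y = zeta3 powi a)"

definition cubic_conductor_divisor :: "nat \<Rightarrow> bool" where
  "cubic_conductor_divisor y \<longleftrightarrow> (prime y \<and> [y = 1] (mod 3)) \<or> y = 9"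

definition residue_graph :: "(nat \<Rightarrow> complex set) \<Rightarrow> nat set \<Rightarrow> nat pair_pre_digraph" where
  "residue_graph \<pp> V =
     \<lparr>pverts = V,
      parcs = {(x, y). x \<in> V \<and> y \<in> V \<and> x \<noteq> y \<and> cubic_residue_symbol \<pp> x y = 1}\<rparr>"

definition attractive :: "('a, 'b) pre_digraph \<Rightarrow> 'a \<Rightarrow> bool" where
  "attractive G v \<longleftrightarrow>
     (\<exists>u\<in>verts G. \<exists>w\<in>verts G. distinct [u, v, w] \<and> u \<rightarrow>\<^bsub>G\<^esub> v \<and> w \<rightarrow>\<^bsub>G\<^esub> v)"

definition repulsive :: "('a, 'b) pre_digraph \<Rightarrow> 'a \<Rightarrow> bool" where
  "repulsive G v \<longleftrightarrow>
     (\<exists>u\<in>verts G. \<exists>w\<in>verts G. distinct [u, v, w] \<and> v \<rightarrow>\<^bsub>G\<^esub> u \<and> v \<rightarrow>\<^bsub>G\<^esub> w)"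

definition delta_invariant :: "('a \<Rightarrow> 'a \<Rightarrow> int) \<Rightarrow> 'a \<Rightarrow> 'a \<Rightarrow> 'a \<Rightarrow> int" where
  "delta_invariant a x y z = a x y * a y z * a z x - a x z * a z y * a y x"

text \<open>
  Permuting \<open>x\<close>, \<open>y\<close>, \<open>z\<close> changes \<open>\<delta>\<close> at most by its sign, so its vanishing modulo 3
  depends only on the set \<open>{x, y, z}\<close>.
\<close>

lemma delta_invariant_rotate: "delta_invariant a y z x = delta_invariant a x y z"
  by (simp add: delta_invariant_def mult.commute mult.left_commute)

lemma delta_invariant_swap: "delta_invariant a x z y = - delta_invariant a x y z"
  by (simp add: delta_invariant_def)

definition type_III_1 :: "('a \<Rightarrow> 'a \<Rightarrow> int) \<Rightarrow> ('a, 'b) pre_digraph \<Rightarrow> bool" where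
  "type_III_1 a H \<longleftrightarrow>
     arcs_ends H = {} \<and>
     (\<forall>x y z. verts H = {x, y, z} \<and> distinct [x, y, z] \<longrightarrow>
        \<not> [delta_invariant a x y z = 0] (mod 3))"

definition type_III_2 :: "('a, 'b) pre_digraph \<Rightarrow> bool" where
  "type_III_2 H \<longleftrightarrow> card (arcs_ends H) = 1"

definition type_III_3 :: "('a, 'b) pre_digraph \<Rightarrow> bool" where
  "type_III_3 H \<longleftrightarrow>
     (\<exists>x y z. verts H = {x, y, z} \<and> distinct [x, y, z] \<and> arcs_ends H = {(x, y), (y, z)})"

definition type_III_4 :: "('a, 'b) pre_digraph \<Rightarrow> bool" where
  "type_III_4 H \<longleftrightarrow>
     (\<exists>x y z. verts H = {x, y, z} \<and> distinct [x, y, z] \<and>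
        arcs_ends H = {(x, y), (y, z), (z, x)})"

end

theory Submission
  imports Defs
begin

text \<open>
  Conditions (1)--(3) say that the arrow relation is asymmetric and a partial injection, so that its
  components are directed paths and directed cycles of length at least 3.  If no two arrows are
  composable, the arrows form a matching, and counting end points bounds their number by half the
  number of vertices.  Otherwise there is a path \<open>w \<rightarrow> x \<rightarrow> y\<close>, which uses up \<open>w\<close> and \<open>x\<close> as sources
  and \<open>x\<close> and \<open>y\<close> as targets; with a fourth vertex \<open>z\<close>, the only further arrows possible are
  \<open>y \<rightarrow> w\<close>, \<open>y \<rightarrow> z\<close> and \<open>z \<rightarrow> w\<close>, the first of which excludes the other two.
\<close>

lemma finite_distinct_list_extend:
  assumes "finite V" "distinct xs" "set xs \<subseteq> V"
  obtains ys where "set (xs @ ys) = V" "distinct (xs @ ys)" "length xs + length ys = card V"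
proof -
  obtain ys where ys: "set ys = V - set xs" "distinct ys"
    using finite_distinct_list[of "V - set xs"] assms(1) by auto
  then have "set (xs @ ys) = V" "distinct (xs @ ys)"
    using assms(2,3) by auto
  then show thesis
    using that distinct_card[of "xs @ ys"] by simp
qed

lemma card_Domain_single_valued:
  assumes "single_valued E"
  shows "card (Domain E) = card E"
proof -
  have "inj_on fst E"
    using assms by (auto simp: inj_on_def dest: single_valuedD)
  then show ?thesis
    by (simp add: Domain_fst card_image)
qed

definition tame_arc_sets :: "'a \<Rightarrow> 'a \<Rightarrow> 'a \<Rightarrow> 'a \<Rightarrow> 'a rel set" where
  "tame_arc_sets p q r s =
     {{},
      {(p, q)},
      {(p, q), (r, s)},
      {(p, q), (q, r)},
      {(p, q), (q, r), (r, p)},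
      {(p, q), (q, r), (r, s)},
      {(p, q), (q, r), (r, s), (s, p)}}"

lemma map_prod_image_tame_arc_sets:
  assumes "A \<in> tame_arc_sets p q r s"
  shows "map_prod f f ` A \<in> tame_arc_sets (f p) (f q) (f r) (f s)"
  using imageI[OF assms, of "(`) (map_prod f f)"]
  by (simp only: tame_arc_sets_def image_insert image_empty map_prod_simp)

locale asym_partial_injection =
  fixes V :: "'a set" and E :: "'a rel"
  assumes subset_Times: "E \<subseteq> V \<times> V"
    and asym: "asym E"
    and single_valued: "single_valued E"
    and single_valued_converse: "single_valued (E\<inverse>)"
begin

lemma asym_partial_injection_Int_Times: "asym_partial_injection T (E \<inter> T \<times> T)"
proof
  show "asym (E \<inter> T \<times> T)"
    using asym by (auto dest: asymD)
  show "single_valued (E \<inter> T \<times> T)"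
    using single_valued by (rule single_valued_subset[rotated]) blast
  show "single_valued ((E \<inter> T \<times> T)\<inverse>)"
    using single_valued_converse by (rule single_valued_subset[rotated]) blast
qed blast

lemma card_le_if_not_composable:
  assumes "finite V" "Domain E \<inter> Range E = {}"
  shows "2 * card E \<le> card V"
proof -
  have ends: "Domain E \<union> Range E \<subseteq> V"
    using subset_Times by blast
  then have "finite (Domain E)" "finite (Range E)"
    using assms(1) by (auto intro: finite_subset)
  then have "card (Domain E \<union> Range E) = card (Domain E) + card (Range E)"
    using assms(2) by (rule card_Un_disjoint)
  also have "\<dots> = 2 * card E"
    using card_Domain_single_valued[OF single_valued]
      card_Domain_single_valued[OF single_valued_converse] by simp
  finally show ?thesis
    using card_mono[OF assms(1) ends] by simp
qed

lemma distinct_composable: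
  assumes "(w, x) \<in> E" "(x, y) \<in> E"
  shows "distinct [w, x, y]"
  using assms asym by (auto dest: asymD)

lemma distinct_not_composable:
  assumes "Domain E \<inter> Range E = {}" "(w, x) \<in> E" "(y, z) \<in> E" "(w, x) \<noteq> (y, z)"
  shows "distinct [w, x, y, z]"
  using assms single_valued single_valued_converse by (auto dest: single_valuedD)

lemma Diff_composable_subset:
  assumes "(w, x) \<in> E" "(x, y) \<in> E"
  shows "E - {(w, x), (x, y)} \<subseteq> (V - {w, x}) \<times> (V - {x, y})"
  using assms subset_Times single_valued single_valued_converse
  by (auto dest: single_valuedD)

lemma card_3_cases:
  assumes "card V = 3"
  obtains "E = {}"
  | x y where "E = {(x, y)}"
  | x y z where "V = {x, y, z}" "distinct [x, y, z]" "E = {(x, y), (y, z)}"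
  | x y z where "V = {x, y, z}" "distinct [x, y, z]" "E = {(x, y), (y, z), (z, x)}"
proof (cases "Domain E \<inter> Range E = {}")
  case True
  have "finite V"
    using assms by (simp add: card_ge_0_finite)
  then have "finite E" "2 * card E \<le> 3"
    using True assms subset_Times card_le_if_not_composable by (auto intro: finite_subset)
  then consider "E = {}" | "card E = 1"
    by (cases "card E") auto
  then show thesis
    using that(1,2) by cases (auto simp: card_1_singleton_iff)
next
  case False
  then obtain x y z where path: "(x, y) \<in> E" "(y, z) \<in> E"
    by blast
  have dist: "distinct [x, y, z]"
    using path by (rule distinct_composable)
  have "{x, y, z} \<subseteq> V"
    using path subset_Times by auto
  then have V: "V = {x, y, z}"
    using assms dist by (intro card_subset_eq[symmetric]) (auto simp: card_ge_0_finite)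
  have "E - {(x, y), (y, z)} \<subseteq> {(z, x)}"
    using Diff_composable_subset[OF path] unfolding V by blast
  then consider "E = {(x, y), (y, z)}" | "E = {(x, y), (y, z), (z, x)}"
    using path by blast
  then show thesis
    using that(3,4) V dist by cases blast+
qed

lemma card_4_not_composable:
  assumes "card V = 4" "Domain E \<inter> Range E = {}"
  obtains w x y z where "V = {w, x, y, z}" "distinct [w, x, y, z]" "E \<in> tame_arc_sets w x y z"
proof -
  have V: "finite V"
    using assms(1) by (simp add: card_ge_0_finite)
  then have "finite E" "2 * card E \<le> 4"
    using assms subset_Times card_le_if_not_composable by (auto intro: finite_subset)
  then consider "card E = 0" | "card E = 1" | "card E = 2"
    by linarith
  then show thesis
  proof cases
    case 1
    obtain ys where "set ys = V" "distinct ys" "length ys = 4"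
      using finite_distinct_list_extend[OF V, of "[]"] assms(1) by auto
    then obtain w x y z where "V = {w, x, y, z}" "distinct [w, x, y, z]"
      by (auto simp: numeral_eq_Suc length_Suc_conv)
    then show thesis
      using 1 \<open>finite E\<close> by (intro that[of w x y z]) (simp_all add: tame_arc_sets_def)
  next
    case 2
    then obtain w x where E: "E = {(w, x)}"
      by (auto simp: card_1_singleton_iff)
    then have "distinct [w, x]" "set [w, x] \<subseteq> V"
      using assms(2) subset_Times by auto
    then obtain ys where "set ([w, x] @ ys) = V" "distinct ([w, x] @ ys)" "length ys = 2"
      using finite_distinct_list_extend[OF V, of "[w, x]"] assms(1) by auto
    then obtain y z where "V = {w, x, y, z}" "distinct [w, x, y, z]"
      by (auto simp: numeral_eq_Suc length_Suc_conv)
    then show thesis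
      using E by (intro that[of w x y z]) (simp_all add: tame_arc_sets_def)
  next
    case 3
    then obtain w x y z where E: "E = {(w, x), (y, z)}" and "(w, x) \<noteq> (y, z)"
      by (auto simp: card_2_iff)
    then have dist: "distinct [w, x, y, z]"
      using assms(2) by (intro distinct_not_composable) auto
    have "{w, x, y, z} \<subseteq> V"
      using E subset_Times by auto
    then have "V = {w, x, y, z}"
      using V assms(1) dist by (intro card_subset_eq[symmetric]) auto
    then show thesis
      using dist E by (intro that[of w x y z]) (simp_all add: tame_arc_sets_def)
  qed
qed

lemma card_4_composable:
  assumes "card V = 4" "Domain E \<inter> Range E \<noteq> {}"
  obtains w x y z where "V = {w, x, y, z}" "distinct [w, x, y, z]" "E \<in> tame_arc_sets w x y z"
proof -
  obtain w x y where path: "(w, x) \<in> E" "(x, y) \<in> E"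
    using assms(2) by blast
  then have "set [w, x, y] \<subseteq> V"
    using subset_Times by auto
  then obtain ys where "set ([w, x, y] @ ys) = V" "distinct ([w, x, y] @ ys)" "length ys = 1"
    using finite_distinct_list_extend[OF _ distinct_composable[OF path], of V] assms(1)
    by (auto simp: card_ge_0_finite)
  then obtain z where V: "V = {w, x, y, z}" and dist: "distinct [w, x, y, z]"
    by (auto simp: length_Suc_conv)
  have "E - {(w, x), (x, y)} \<subseteq> {y, z} \<times> {w, z}"
    using Diff_composable_subset[OF path] unfolding V by blast
  moreover have "(z, z) \<notin> E"
    using asym by (auto dest: asymD)
  moreover have "(y, z) \<notin> E" "(z, w) \<notin> E" if "(y, w) \<in> E"
    using that dist single_valued single_valued_converse by (auto dest: single_valuedD)
  ultimately consider "E = {(w, x), (x, y)}" | "E = {(w, x), (x, y), (y, w)}"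
    | "E = {(w, x), (x, y), (y, z)}" | "E = {(z, w), (w, x), (x, y)}"
    | "E = {(w, x), (x, y), (y, z), (z, w)}"
    using path by blast
  then show thesis
  proof cases
    case 4
    show thesis
      using dist 4 by (intro that[of z w x y]) (auto simp: V tame_arc_sets_def)
  qed (rule that[OF V dist], simp add: tame_arc_sets_def)+
qed

lemma card_4_cases:
  assumes "card V = 4"
  obtains w x y z where "V = {w, x, y, z}" "distinct [w, x, y, z]" "E \<in> tame_arc_sets w x y z"
proof (cases "Domain E \<inter> Range E = {}")
  case True
  with assms show thesis
    using that by (rule card_4_not_composable)
next
  case False
  with assms show thesis
    using that by (rule card_4_composable)
qed

end

lemma arcs_ends_induce_subgraph: "arcs_ends (G \<restriction> T) = arcs_ends G \<inter> T \<times> T"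
  by (auto simp: arcs_ends_conv)

lemma (in nomulti_digraph) digraph_iso_with_proj_image:
  assumes "inj_on f (verts G)"
  shows "digraph_iso G
    (with_proj \<lparr>pverts = f ` verts G, parcs = map_prod f f ` arcs_ends G\<rparr>)"
    (is "digraph_iso G ?H")
proof -
  define h where
    "h = \<lparr>iso_verts = f, iso_arcs = map_prod f f \<circ> arc_to_ends G, iso_head = snd, iso_tail = fst\<rparr>"
  have "inj_on (map_prod f f) (arcs_ends G)"
    using map_prod_inj_on[OF assms assms] by (rule inj_on_subset) (auto simp: arcs_ends_conv)
  then have "inj_on (map_prod f f \<circ> arc_to_ends G) (arcs G)"
    using inj_on_arc_to_ends by (simp add: comp_inj_on arcs_ends_def)
  then have "digraph_isomorphism h"
    using assms wf_digraph_axioms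
    by (simp add: digraph_isomorphism_def h_def arc_to_ends_def)
  moreover have "?H = app_iso h G"
    by (simp add: app_iso_def h_def with_proj_def arcs_ends_def image_comp)
  ultimately show ?thesis
    unfolding digraph_iso_def by blast
qed

context loopfree_digraph
begin

lemma repulsive_iff: "repulsive G v \<longleftrightarrow> (\<exists>u w. u \<noteq> w \<and> v \<rightarrow>\<^bsub>G\<^esub> u \<and> v \<rightarrow>\<^bsub>G\<^esub> w)"
  by (simp add: repulsive_def) (metis adj_in_verts adj_not_same)

lemma attractive_iff: "attractive G v \<longleftrightarrow> (\<exists>u w. u \<noteq> w \<and> u \<rightarrow>\<^bsub>G\<^esub> v \<and> w \<rightarrow>\<^bsub>G\<^esub> v)"
  by (simp add: attractive_def) (metis adj_in_verts adj_not_same)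

lemma single_valued_arcs_ends_iff:
  "single_valued (arcs_ends G) \<longleftrightarrow> \<not> (\<exists>v\<in>verts G. repulsive G v)"
  unfolding single_valued_def repulsive_iff using adj_in_verts(1) by blast

lemma single_valued_converse_arcs_ends_iff:
  "single_valued ((arcs_ends G)\<inverse>) \<longleftrightarrow> \<not> (\<exists>v\<in>verts G. attractive G v)"
  unfolding single_valued_def attractive_iff converse_iff using adj_in_verts(2) by blast

end

lemma (in wf_digraph) asym_arcs_ends_iff:
  "asym (arcs_ends G) \<longleftrightarrow> \<not> (\<exists>x\<in>verts G. \<exists>y\<in>verts G. x \<rightarrow>\<^bsub>G\<^esub> y \<and> y \<rightarrow>\<^bsub>G\<^esub> x)"
  unfolding asym_on_def using adj_in_verts by blast

locale tame_digraph = loopfree_digraph + nomulti_digraph +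
  fixes a :: "'a \<Rightarrow> 'a \<Rightarrow> int"
  assumes no_mutual_arcs: "\<not> (\<exists>x\<in>verts G. \<exists>y\<in>verts G. x \<rightarrow>\<^bsub>G\<^esub> y \<and> y \<rightarrow>\<^bsub>G\<^esub> x)"
    and no_attractive: "\<not> (\<exists>v\<in>verts G. attractive G v)"
    and no_repulsive: "\<not> (\<exists>v\<in>verts G. repulsive G v)"
    and delta_invariant_nonzero: "\<forall>x\<in>verts G. \<forall>y\<in>verts G. \<forall>z\<in>verts G.
      distinct [x, y, z] \<and> arcs (G \<restriction> {x, y, z}) = {} \<longrightarrow>
      \<not> [delta_invariant a x y z = 0] (mod 3)"
begin

sublocale asym_partial_injection "verts G" "arcs_ends G"
proof
  show "arcs_ends G \<subseteq> verts G \<times> verts G"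
    by (auto simp: arcs_ends_conv)
  show "asym (arcs_ends G)"
    using no_mutual_arcs by (rule asym_arcs_ends_iff[THEN iffD2])
  show "single_valued (arcs_ends G)"
    using no_repulsive by (rule single_valued_arcs_ends_iff[THEN iffD2])
  show "single_valued ((arcs_ends G)\<inverse>)"
    using no_attractive by (rule single_valued_converse_arcs_ends_iff[THEN iffD2])
qed

lemma type_III_1_induce_subgraph:
  assumes "T \<subseteq> verts G" "arcs_ends (G \<restriction> T) = {}"
  shows "type_III_1 a (G \<restriction> T)"
proof -
  have "\<not> [delta_invariant a x y z = 0] (mod 3)" if "T = {x, y, z}" "distinct [x, y, z]" for x y z
  proof -
    have "arcs (G \<restriction> {x, y, z}) = {}"
      using assms(2) that(1) by (simp add: arcs_ends_def)
    moreover have "x \<in> verts G" "y \<in> verts G" "z \<in> verts G"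
      using assms(1) that(1) by auto
    ultimately show ?thesis
      using delta_invariant_nonzero that(2) by blast
  qed
  then show ?thesis
    using assms(2) by (auto simp: type_III_1_def)
qed

theorem induced_triple_type:
  assumes "T \<subseteq> verts G" "card T = 3"
  shows "type_III_1 a (G \<restriction> T) \<or> type_III_2 (G \<restriction> T) \<or>
    type_III_3 (G \<restriction> T) \<or> type_III_4 (G \<restriction> T)"
proof -
  interpret T: asym_partial_injection T "arcs_ends (G \<restriction> T)"
    unfolding arcs_ends_induce_subgraph by (rule asym_partial_injection_Int_Times)
  show ?thesis
  proof (cases rule: T.card_3_cases[OF assms(2)])
    case 1
    with assms(1) have "type_III_1 a (G \<restriction> T)"
      by (rule type_III_1_induce_subgraph)
    then show ?thesis by simp
  next
    case 2
    then have "type_III_2 (G \<restriction> T)"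
      by (simp add: type_III_2_def)
    then show ?thesis by simp
  next
    case 3
    then have "type_III_3 (G \<restriction> T)"
      unfolding type_III_3_def induce_subgraph_verts by blast
    then show ?thesis by simp
  next
    case 4
    then have "type_III_4 (G \<restriction> T)"
      unfolding type_III_4_def induce_subgraph_verts by blast
    then show ?thesis by simp
  qed
qed

theorem digraph_iso_tame_arc_set:
  assumes "card (verts G) = 4" "distinct [p, q, r, s]"
  obtains A where "A \<in> tame_arc_sets p q r s"
    "digraph_iso G (with_proj \<lparr>pverts = {p, q, r, s}, parcs = A\<rparr>)"
proof -
  obtain w x y z where V: "verts G = {w, x, y, z}" and dist: "distinct [w, x, y, z]"
    and E: "arcs_ends G \<in> tame_arc_sets w x y z"
    using assms(1) by (rule card_4_cases)
  define f where "f = (\<lambda>_. s)(w := p, x := q, y := r)"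
  have f: "f w = p" "f x = q" "f y = r" "f z = s"
    using dist by (auto simp: f_def)
  have "inj_on f (verts G)"
    using assms(2) by (auto simp: V f)
  then have "digraph_iso G
      (with_proj \<lparr>pverts = {p, q, r, s}, parcs = map_prod f f ` arcs_ends G\<rparr>)"
    using digraph_iso_with_proj_image[of f] by (simp add: V f)
  moreover have "map_prod f f ` arcs_ends G \<in> tame_arc_sets p q r s"
    using map_prod_image_tame_arc_sets[OF E, of f] by (simp only: f)
  ultimately show thesis
    using that by blast
qed

end

lemma loopfree_digraph_residue_graph: "loopfree_digraph (with_proj (residue_graph \<pp> V))"
  and nomulti_digraph_residue_graph: "nomulti_digraph (with_proj (residue_graph \<pp> V))"
  by unfold_locales (auto simp: residue_graph_def arc_to_ends_def)

theorem theoremA: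
  fixes c p q r s :: nat
    and \<pp> :: "nat \<Rightarrow> complex set"
    and a :: "nat \<Rightarrow> nat \<Rightarrow> int"
    and G :: "(nat, nat \<times> nat) pre_digraph"
  assumes "c = p * q * r * s"
    and "distinct [p, q, r, s]"
    and "\<forall>y\<in>{p, q, r, s}. cubic_conductor_divisor y"
    and "\<forall>y\<in>{p, q, r, s}. prime_above (\<pp> y) y"
    and "a = cubic_residue_exponent \<pp>"
    and "G = with_proj (residue_graph \<pp> {p, q, r, s})"
    and "\<not> (\<exists>x\<in>verts G. \<exists>y\<in>verts G. x \<rightarrow>\<^bsub>G\<^esub> y \<and> y \<rightarrow>\<^bsub>G\<^esub> x)"
    and "\<not> (\<exists>v\<in>verts G. attractive G v)"
    and "\<not> (\<exists>v\<in>verts G. repulsive G v)"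
    and "\<forall>x\<in>verts G. \<forall>y\<in>verts G. \<forall>z\<in>verts G.
           distinct [x, y, z] \<and> arcs (G \<restriction> {x, y, z}) = {} \<longrightarrow>
           \<not> [delta_invariant a x y z = 0] (mod 3)"
  shows "(\<forall>T\<in>{{p, q, r}, {p, q, s}, {p, r, s}, {q, r, s}}.
            type_III_1 a (G \<restriction> T) \<or> type_III_2 (G \<restriction> T) \<or>
            type_III_3 (G \<restriction> T) \<or> type_III_4 (G \<restriction> T)) \<and>
         (\<exists>A\<in>{{},
               {(p, q)},
               {(p, q), (r, s)},
               {(p, q), (q, r)},
               {(p, q), (q, r), (r, p)},
               {(p, q), (q, r), (r, s)},
               {(p, q), (q, r), (r, s), (s, p)}}.
            digraph_iso G (with_proj \<lparr>pverts = {p, q, r, s}, parcs = A\<rparr>))"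
proof -
  interpret tame_digraph G a
  proof (intro tame_digraph.intro tame_digraph_axioms.intro)
    show "loopfree_digraph G" "nomulti_digraph G"
      unfolding assms(6)
      by (rule loopfree_digraph_residue_graph nomulti_digraph_residue_graph)+
  qed (fact assms)+
  have verts: "verts G = {p, q, r, s}"
    by (simp add: assms(6) residue_graph_def)
  then have "card (verts G) = 4"
    using assms(2) by simp
  then obtain A where A: "A \<in> tame_arc_sets p q r s"
    and iso: "digraph_iso G (with_proj \<lparr>pverts = {p, q, r, s}, parcs = A\<rparr>)"
    using assms(2) by (rule digraph_iso_tame_arc_set)
  show ?thesis
  proof (intro conjI ballI)
    fix T assume "T \<in> {{p, q, r}, {p, q, s}, {p, r, s}, {q, r, s}}"
    then have "T \<subseteq> verts G" "card T = 3"
      using assms(2) by (auto simp: verts)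
    then show "type_III_1 a (G \<restriction> T) \<or> type_III_2 (G \<restriction> T) \<or>
        type_III_3 (G \<restriction> T) \<or> type_III_4 (G \<restriction> T)"
      by (rule induced_triple_type)
  qed (rule bexI[OF _ A[unfolded tame_arc_sets_def]], rule iso)
qed

end
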